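(* Every weakly Hopfian finitely presented group is strongly defined by its $\exists^+$-types.
   Context: A group $A$ is weakly Hopfian if every $\alpha\in\mathrm{End}(A)$ having a left inverse (i.e. there is $\beta\in\mathrm{End}(A)$ with $\beta\circ\alpha=\mathrm{id}_A$) is an automorphism of $A$. An $\exists^+$-formula (positive existential formula) is a first-order formula $\exists\bar y\,\theta(\bar x,\bar y)$ in the language of groups with $\theta$ a positive quantifier-free formula (built from equations between words using $\wedge$ and $\vee$). A map $f:A\to B$ between groups is an $\exists^+$-embedding if for every $\exists^+$-formula $\varphi(\bar x)$ and every tuple $\bar a$ from $A$ of the length of $\bar x$: $A\models\varphi(\bar a)$ if and only if $B\models\varphi(f(\bar a))$. A finitely generated group $A$ is strongly defined by its $\exists^+$-types if every $\exists^+$-embedding $f:A\to A$ is an automorphism of $A$. *)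

theory Defs
  imports "HOL-Algebra.Generated_Groups"
begin

section \<open>Group words\<close>

datatype 'x letter = Gen 'x | GenInv 'x

type_synonym 'x word = "'x letter list"

fun letter_inv :: "'x letter \<Rightarrow> 'x letter" where
  "letter_inv (Gen x) = GenInv x"
| "letter_inv (GenInv x) = Gen x"

fun letter_val :: "('a, 'b) monoid_scheme \<Rightarrow> ('x \<Rightarrow> 'a) \<Rightarrow> 'x letter \<Rightarrow> 'a" where
  "letter_val G v (Gen x) = v x"
| "letter_val G v (GenInv x) = inv\<^bsub>G\<^esub> (v x)"

fun word_val :: "('a, 'b) monoid_scheme \<Rightarrow> ('x \<Rightarrow> 'a) \<Rightarrow> 'x word \<Rightarrow> 'a" where
  "word_val G v [] = \<one>\<^bsub>G\<^esub>"
| "word_val G v (l # w) = letter_val G v l \<otimes>\<^bsub>G\<^esub> word_val G v w"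


section \<open>Free groups and finite presentations\<close>

text \<open>The free group on \<open>X\<close> consists of the freely reduced words in the letters \<open>Gen x\<close> and
  \<open>GenInv x\<close> with \<open>x \<in> X\<close>, multiplied by concatenation followed by free reduction.\<close>

fun reduced :: "'x word \<Rightarrow> bool" where
  "reduced [] \<longleftrightarrow> True"
| "reduced [l] \<longleftrightarrow> True"
| "reduced (l # m # w) \<longleftrightarrow> m \<noteq> letter_inv l \<and> reduced (m # w)"

fun cons_reduce :: "'x letter \<Rightarrow> 'x word \<Rightarrow> 'x word" where
  "cons_reduce l [] = [l]"
| "cons_reduce l (m # w) = (if m = letter_inv l then w else l # m # w)"

definition free_reduce :: "'x word \<Rightarrow> 'x word" where
  "free_reduce w = foldr cons_reduce w []"

definition free_group :: "'x set \<Rightarrow> 'x word monoid" where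
  "free_group X =
     \<lparr>carrier = {w. reduced w \<and> (\<forall>l\<in>set w. set_letter l \<subseteq> X)},
      monoid.mult = (\<lambda>u v. free_reduce (u @ v)),
      one = []\<rparr>"

definition normal_closure :: "('a, 'b) monoid_scheme \<Rightarrow> 'a set \<Rightarrow> 'a set" where
  "normal_closure G R = \<Inter>{N. N \<lhd> G \<and> R \<subseteq> N}"

text \<open>Every finite generating set can be indexed by natural numbers, so it is no restriction to
  take the generators of a finite presentation from \<^typ>\<open>nat\<close>.\<close>

definition finitely_presented :: "('a, 'b) monoid_scheme \<Rightarrow> bool" where
  "finitely_presented G \<longleftrightarrow>
     (\<exists>(X :: nat set) R. finite X \<and> finite R \<and> R \<subseteq> carrier (free_group X) \<and>
        G \<cong> free_group X Mod normal_closure (free_group X) R)"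

definition finitely_generated :: "('a, 'b) monoid_scheme \<Rightarrow> bool" where
  "finitely_generated G \<longleftrightarrow>
     (\<exists>S. finite S \<and> S \<subseteq> carrier G \<and> generate G S = carrier G)"


section \<open>Weakly Hopfian groups\<close>

definition weakly_hopfian :: "('a, 'b) monoid_scheme \<Rightarrow> bool" where
  "weakly_hopfian A \<longleftrightarrow>
     (\<forall>\<alpha>\<in>hom A A. (\<exists>\<beta>\<in>hom A A. \<forall>x\<in>carrier A. \<beta> (\<alpha> x) = x) \<longrightarrow> \<alpha> \<in> iso A A)"


section \<open>Positive existential formulas\<close>

datatype (pqf_vars: 'v) pos_qf =
    Eq "'v word" "'v word"
  | Conj "'v pos_qf" "'v pos_qf"
  | Disj "'v pos_qf" "'v pos_qf"

primrec pqf_holds :: "('a, 'b) monoid_scheme \<Rightarrow> ('v \<Rightarrow> 'a) \<Rightarrow> 'v pos_qf \<Rightarrow> bool" where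
  "pqf_holds G v (Eq s t) \<longleftrightarrow> word_val G v s = word_val G v t"
| "pqf_holds G v (Conj p q) \<longleftrightarrow> pqf_holds G v p \<and> pqf_holds G v q"
| "pqf_holds G v (Disj p q) \<longleftrightarrow> pqf_holds G v p \<or> pqf_holds G v q"

text \<open>\<open>Exists m \<theta>\<close> stands for \<open>\<exists>y\<^sub>0 \<dots> y\<^sub>m\<^sub>-\<^sub>1. \<theta>\<close>, where the variable \<open>Inl i\<close> of \<open>\<theta>\<close> is the
  free variable \<open>x\<^sub>i\<close> and the variable \<open>Inr j\<close> is the bound variable \<open>y\<^sub>j\<close>.\<close>

datatype pos_ex_formula = Exists nat "(nat + nat) pos_qf"

fun pos_ex_formula_in :: "nat \<Rightarrow> pos_ex_formula \<Rightarrow> bool" where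
  "pos_ex_formula_in k (Exists m \<theta>) \<longleftrightarrow> pqf_vars \<theta> \<subseteq> {..<k} <+> {..<m}"

fun models :: "('a, 'b) monoid_scheme \<Rightarrow> pos_ex_formula \<Rightarrow> 'a list \<Rightarrow> bool" where
  "models G (Exists m \<theta>) as \<longleftrightarrow>
     (\<exists>bs. length bs = m \<and> set bs \<subseteq> carrier G \<and>
        pqf_holds G (case_sum (\<lambda>i. as ! i) (\<lambda>j. bs ! j)) \<theta>)"

definition pos_ex_embedding ::
  "('a, 'b) monoid_scheme \<Rightarrow> ('c, 'd) monoid_scheme \<Rightarrow> ('a \<Rightarrow> 'c) \<Rightarrow> bool" where
  "pos_ex_embedding A B f \<longleftrightarrow>
     f \<in> carrier A \<rightarrow> carrier B \<and>
     (\<forall>k \<phi> as. pos_ex_formula_in k \<phi> \<and> length as = k \<and> set as \<subseteq> carrier A \<longrightarrow>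
        (models A \<phi> as \<longleftrightarrow> models B \<phi> (map f as)))"

definition strongly_defined_by_pos_ex_types :: "('a, 'b) monoid_scheme \<Rightarrow> bool" where
  "strongly_defined_by_pos_ex_types A \<longleftrightarrow>
     finitely_generated A \<and> (\<forall>f. pos_ex_embedding A A f \<longrightarrow> f \<in> iso A A)"


section \<open>The free group is a group\<close>

lemma letter_inv_inv [simp]: "letter_inv (letter_inv l) = l"
  by (cases l) auto

lemma set_letter_inv [simp]: "set_letter (letter_inv l) = set_letter l"
  by (cases l) auto

lemma reduced_ConsD: "reduced (l # w) \<Longrightarrow> reduced w"
  by (cases w) auto

lemma reduced_cons_reduce: "reduced w \<Longrightarrow> reduced (cons_reduce l w)"
  by (cases w) (auto dest: reduced_ConsD)

lemma cons_reduce_reduced: "reduced (l # w) \<Longrightarrow> cons_reduce l w = l # w"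
  by (cases w) auto

lemma cons_reduce_inverse:
  assumes "reduced w"
  shows "cons_reduce l (cons_reduce (letter_inv l) w) = w"
proof (cases w)
  case Nil
  then show ?thesis by simp
next
  case (Cons m u)
  with assms cons_reduce_reduced[of m u] show ?thesis by auto
qed

lemma foldr_cons_reduce_reduced: "reduced w \<Longrightarrow> reduced (foldr cons_reduce u w)"
  by (induction u) (auto intro: reduced_cons_reduce)

lemma reduced_free_reduce: "reduced (free_reduce w)"
  by (simp add: free_reduce_def foldr_cons_reduce_reduced)

lemma free_reduce_reduced: "reduced w \<Longrightarrow> free_reduce w = w"
proof (induction w)
  case (Cons l w)
  then show ?case
    using reduced_ConsD cons_reduce_reduced by (fastforce simp: free_reduce_def)
qed (simp add: free_reduce_def)

lemma foldr_cons_reduce_cons_reduce: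
  assumes "reduced w"
  shows "foldr cons_reduce (cons_reduce l u) w = cons_reduce l (foldr cons_reduce u w)"
proof (cases u)
  case (Cons m v)
  then show ?thesis
    using cons_reduce_inverse[OF foldr_cons_reduce_reduced[OF assms, of v], of l] by simp
qed simp

lemma foldr_cons_reduce_free_reduce:
  "reduced w \<Longrightarrow> foldr cons_reduce (free_reduce u) w = foldr cons_reduce u w"
  by (induction u) (simp_all add: free_reduce_def foldr_cons_reduce_cons_reduce)

lemma free_reduce_append_left: "free_reduce (free_reduce u @ v) = free_reduce (u @ v)"
  using foldr_cons_reduce_free_reduce[OF reduced_free_reduce[of v], of u]
  by (simp add: free_reduce_def)

lemma free_reduce_append_right: "free_reduce (u @ free_reduce v) = free_reduce (u @ v)"
  using free_reduce_reduced[OF reduced_free_reduce[of v]]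
  by (simp add: free_reduce_def)

lemma set_cons_reduce: "set (cons_reduce l w) \<subseteq> insert l (set w)"
  by (cases w) auto

lemma set_free_reduce: "set (free_reduce w) \<subseteq> set w"
  unfolding free_reduce_def
proof (induction w)
  case (Cons l w)
  then show ?case
    using set_cons_reduce[of l "foldr cons_reduce w []"] by auto
qed simp

lemma foldr_cons_reduce_inverse:
  "reduced w \<Longrightarrow> foldr cons_reduce (map letter_inv (rev u)) (foldr cons_reduce u w) = w"
proof (induction u arbitrary: w)
  case (Cons l u)
  then show ?case
    using cons_reduce_inverse[of "foldr cons_reduce u w" "letter_inv l"]
    by (simp add: foldr_cons_reduce_reduced)
qed simp

lemma group_free_group: "group (free_group X)"
proof (rule groupI)
  fix u v assume "u \<in> carrier (free_group X)" "v \<in> carrier (free_group X)"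
  then show "u \<otimes>\<^bsub>free_group X\<^esub> v \<in> carrier (free_group X)"
    using set_free_reduce[of "u @ v"]
    by (auto simp: free_group_def reduced_free_reduce dest!: subsetD)
next
  fix u v w
  show "u \<otimes>\<^bsub>free_group X\<^esub> v \<otimes>\<^bsub>free_group X\<^esub> w =
    u \<otimes>\<^bsub>free_group X\<^esub> (v \<otimes>\<^bsub>free_group X\<^esub> w)"
    by (simp add: free_group_def free_reduce_append_left free_reduce_append_right)
next
  fix u assume u: "u \<in> carrier (free_group X)"
  then show "\<one>\<^bsub>free_group X\<^esub> \<otimes>\<^bsub>free_group X\<^esub> u = u"
    by (simp add: free_group_def free_reduce_reduced)
  let ?v = "free_reduce (map letter_inv (rev u))"
  have "?v \<in> carrier (free_group X)"
    using u set_free_reduce[of "map letter_inv (rev u)"]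
    by (fastforce simp: free_group_def reduced_free_reduce dest: subsetD)
  moreover have "?v \<otimes>\<^bsub>free_group X\<^esub> u = \<one>\<^bsub>free_group X\<^esub>"
    using foldr_cons_reduce_inverse[of "[]" u]
    by (simp add: free_group_def free_reduce_append_left) (simp add: free_reduce_def)
  ultimately show "\<exists>v\<in>carrier (free_group X). v \<otimes>\<^bsub>free_group X\<^esub> u = \<one>\<^bsub>free_group X\<^esub>"
    by blast
qed (simp add: free_group_def)

end

theory Submission
  imports Defs
begin

text \<open>Let \<open>a\<close> be the generating tuple of a finite presentation of \<open>A\<close> with relators \<open>R\<close>, let \<open>f\<close> be
  an \<open>\<exists>\<^sup>+\<close>-embedding, and write \<open>f a\<^sub>j = w\<^sub>j(a)\<close>. The formula
  \<open>\<exists>y. (\<And>r\<in>R. r(y) = 1) \<and> (\<And>j. x\<^sub>j = w\<^sub>j(y))\<close> holds at \<open>f a\<close>, with witness \<open>y = a\<close>, hence at \<open>a\<close>.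
  A witness \<open>b\<close> for the latter satisfies the relators, so \<open>a\<^sub>j \<mapsto> b\<^sub>j\<close> extends to an endomorphism
  \<open>\<beta>\<close>, and \<open>\<beta> (f a\<^sub>j) = w\<^sub>j(b) = a\<^sub>j\<close>. Thus \<open>f\<close> has a left inverse, and weak Hopficity applies.\<close>

section \<open>Words and the free group\<close>

abbreviation word_over :: "'x set \<Rightarrow> 'x word \<Rightarrow> bool" where
  "word_over X w \<equiv> \<forall>l\<in>set w. set_letter l \<subseteq> X"

lemma carrier_free_group: "w \<in> carrier (free_group X) \<longleftrightarrow> reduced w \<and> word_over X w"
  by (simp add: free_group_def)

lemma mult_free_group: "u \<otimes>\<^bsub>free_group X\<^esub> v = free_reduce (u @ v)"
  by (simp add: free_group_def)

lemma one_free_group: "\<one>\<^bsub>free_group X\<^esub> = []"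
  by (simp add: free_group_def)

lemma word_val_cong:
  "word_over X w \<Longrightarrow> (\<And>x. x \<in> X \<Longrightarrow> v x = v' x) \<Longrightarrow> word_val G v w = word_val G v' w"
proof (induction w)
  case (Cons l w)
  then show ?case by (cases l) auto
qed simp

lemma word_val_map: "word_val G v (map (map_letter g) w) = word_val G (v \<circ> g) w"
proof (induction w)
  case (Cons l w)
  then show ?case by (cases l) auto
qed simp

lemma letter_val_free_group:
  assumes "set_letter l \<subseteq> X"
  shows "letter_val (free_group X) (\<lambda>x. [Gen x]) l = [l]"
proof (cases l)
  case (GenInv x)
  interpret F: group "free_group X" by (rule group_free_group)
  have "inv\<^bsub>free_group X\<^esub> [Gen x] = [GenInv x]"
    using assms GenInv
    by (intro F.inv_equality)
      (simp_all add: mult_free_group one_free_group carrier_free_group free_reduce_def)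
  then show ?thesis using GenInv by simp
qed simp

text \<open>Suffixes of a reduced word are reduced, so no cancellation ever happens. This lets a
  homomorphism out of the free group be read as word evaluation at the images of the
  generators.\<close>

lemma word_val_free_group:
  "w \<in> carrier (free_group X) \<Longrightarrow> word_val (free_group X) (\<lambda>x. [Gen x]) w = w"
proof (induction w)
  case (Cons l w)
  then have "w \<in> carrier (free_group X)"
    by (auto simp: carrier_free_group dest: reduced_ConsD)
  with Cons show ?case
    by (simp add: letter_val_free_group carrier_free_group mult_free_group free_reduce_reduced)
qed (simp add: one_free_group)

section \<open>Evaluating words in a group\<close>

context group
begin

lemma letter_val_closed:
  "v \<in> X \<rightarrow> carrier G \<Longrightarrow> set_letter l \<subseteq> X \<Longrightarrow> letter_val G v l \<in> carrier G"
  by (cases l) auto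

lemma word_val_closed:
  "v \<in> X \<rightarrow> carrier G \<Longrightarrow> word_over X w \<Longrightarrow> word_val G v w \<in> carrier G"
  by (induction w) (simp_all add: letter_val_closed)

lemma word_val_append:
  "v \<in> X \<rightarrow> carrier G \<Longrightarrow> word_over X u \<Longrightarrow> word_over X w \<Longrightarrow>
    word_val G v (u @ w) = word_val G v u \<otimes> word_val G v w"
  by (induction u) (auto simp: word_val_closed letter_val_closed m_assoc)

lemma word_val_cons_reduce:
  assumes v: "v \<in> X \<rightarrow> carrier G" and l: "set_letter l \<subseteq> X" and w: "word_over X w"
  shows "word_val G v (cons_reduce l w) = letter_val G v l \<otimes> word_val G v w"
proof (cases w)
  case (Cons m u)
  have u: "word_val G v u \<in> carrier G"
    using word_val_closed[OF v] w Cons by simp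
  have "letter_val G v l \<otimes> letter_val G v (letter_inv l) = \<one>"
    using v l by (cases l) (auto simp: Pi_iff)
  with u have "letter_val G v l \<otimes> (letter_val G v (letter_inv l) \<otimes> word_val G v u) = word_val G v u"
    using letter_val_closed[OF v] l by (simp flip: m_assoc)
  then show ?thesis using Cons by simp
qed simp

lemma word_val_free_reduce:
  "v \<in> X \<rightarrow> carrier G \<Longrightarrow> word_over X w \<Longrightarrow> word_val G v (free_reduce w) = word_val G v w"
proof (induction w)
  case (Cons l w)
  moreover have "word_over X (free_reduce w)"
    using Cons.prems set_free_reduce[of w] by auto
  ultimately show ?case
    by (simp add: free_reduce_def word_val_cons_reduce)
qed (simp add: free_reduce_def)

text \<open>The existence half of the universal property of the free group. Free reduction preserves
  values because cancelling letters have mutually inverse values.\<close>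

lemma word_val_hom: "v \<in> X \<rightarrow> carrier G \<Longrightarrow> word_val G v \<in> hom (free_group X) G"
  by (rule homI) (simp_all add: mult_free_group carrier_free_group word_val_closed
      word_val_free_reduce[where X = X] word_val_append[where X = X] ball_Un)

lemma word_val_in_generate:
  assumes "word_over X w"
  shows "word_val G v w \<in> generate G (v ` X)"
  using assms
proof (induction w)
  case (Cons l w)
  then show ?case
    by (cases l) (auto intro: generate.intros)
qed (simp add: generate.one)

end

section \<open>Factoring homomorphisms, and normal closures\<close>

context group_hom
begin

lemma hom_word_val:
  assumes v: "v \<in> X \<rightarrow> carrier G"
  shows "word_over X w \<Longrightarrow> h (word_val G v w) = word_val H (h \<circ> v) w"
proof (induction w)
  case (Cons l w)
  moreover have "h (letter_val G v l) = letter_val H (h \<circ> v) l"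
    using Cons.prems v by (cases l) (auto simp: Pi_iff)
  ultimately show ?case
    using v by (simp add: G.word_val_closed G.letter_val_closed del: comp_apply)
qed simp

text \<open>Apply \<open>q\<close> to any preimage under \<open>h\<close>: two preimages differ by
  an element of \<open>kernel G H h\<close>, which \<open>q\<close> kills, so the choice does not
  matter.\<close>

lemma factor_through_surj:
  assumes surj: "h ` carrier G = carrier H" and K: "group K" and q: "q \<in> hom G K"
    and ker: "kernel G H h \<subseteq> kernel G K q"
  obtains \<beta> where "\<beta> \<in> hom H K" "\<And>x. x \<in> carrier G \<Longrightarrow> \<beta> (h x) = q x"
proof
  interpret q: group_hom G K q
    using K q by (simp add: group_hom_def group_hom_axioms_def)
  let ?\<beta> = "\<lambda>y. q (inv_into (carrier G) h y)"
  show \<beta>: "?\<beta> (h x) = q x" if x: "x \<in> carrier G" for x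
  proof -
    let ?z = "inv_into (carrier G) h (h x)"
    have z: "?z \<in> carrier G" "h ?z = h x"
      using x by (auto intro: inv_into_into f_inv_into_f)
    then have "?z \<otimes> inv x \<in> kernel G H h"
      using x by (simp add: kernel_def)
    then have "q ?z \<otimes>\<^bsub>K\<^esub> inv\<^bsub>K\<^esub> q x = \<one>\<^bsub>K\<^esub>"
      using subsetD[OF ker] x z(1) by (fastforce simp: kernel_def)
    then show ?thesis
      using x z by (metis q.H.inv_equality q.H.inv_inv q.H.inv_closed q.hom_closed)
  qed
  show "?\<beta> \<in> hom H K"
  proof (rule homI)
    fix y assume "y \<in> carrier H"
    then show "?\<beta> y \<in> carrier K"
      using surj inv_into_into[of y h "carrier G"] by simp
  next
    fix y y' assume "y \<in> carrier H" "y' \<in> carrier H"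
    then obtain x x' where "x \<in> carrier G" "y = h x" "x' \<in> carrier G" "y' = h x'"
      using surj by blast
    then show "?\<beta> (y \<otimes>\<^bsub>H\<^esub> y') = ?\<beta> y \<otimes>\<^bsub>K\<^esub> ?\<beta> y'"
      using \<beta> by (simp flip: hom_mult)
  qed
qed

end

lemma (in group) normal_closure_normal:
  assumes "R \<subseteq> carrier G"
  shows "normal_closure G R \<lhd> G"
proof -
  let ?\<N> = "{N. N \<lhd> G \<and> R \<subseteq> N}"
  \<comment> \<open>An empty intersection would be \<open>UNIV\<close>, so the family needs a
    member; the whole group is one because it contains \<open>R\<close>.\<close>
  have "carrier G \<lhd> G"
    by (rule normal_invI) (auto intro: subgroup_self)
  with assms have ne: "?\<N> \<noteq> {}" by blast
  show ?thesis
    unfolding normal_closure_def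
  proof (rule normal_invI)
    show "subgroup (\<Inter>?\<N>) G"
      using ne by (intro subgroups_Inter) (auto intro: normal_imp_subgroup)
  qed (auto intro: normal.inv_op_closed2)
qed

text \<open>The kernel is itself one of the normal subgroups being intersected.\<close>

lemma (in group_hom) normal_closure_subset_kernel:
  assumes "R \<subseteq> carrier G" "\<And>r. r \<in> R \<Longrightarrow> h r = \<one>\<^bsub>H\<^esub>"
  shows "normal_closure G R \<subseteq> kernel G H h"
  using assms normal_kernel unfolding normal_closure_def by (auto simp: kernel_def)

section \<open>Finite presentations as evaluation maps\<close>

lemma finitely_presented_cases:
  assumes "group A" "finitely_presented A"
  obtains X :: "nat set" and R v where
    "finite X" "finite R" "R \<subseteq> carrier (free_group X)" "v \<in> UNIV \<rightarrow> carrier A"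
    "word_val A v ` carrier (free_group X) = carrier A"
    "kernel (free_group X) A (word_val A v) = normal_closure (free_group X) R"
proof -
  interpret A: group A by fact
  obtain X :: "nat set" and R where fin: "finite X" "finite R" and R: "R \<subseteq> carrier (free_group X)"
    and iso: "A \<cong> free_group X Mod normal_closure (free_group X) R"
    using assms(2) unfolding finitely_presented_def by blast
  define F where "F = free_group X"
  define N where "N = normal_closure F R"
  interpret F: group F unfolding F_def by (rule group_free_group)
  interpret N: normal N F
    unfolding N_def using R F.normal_closure_normal by (simp add: F_def)
  obtain g where g: "g \<in> iso (F Mod N) A"
    using A.iso_sym[OF iso] unfolding F_def N_def is_iso_def by blast
  \<comment> \<open>The quotient projection followed by the isomorphism \<open>g\<close>: a
    surjection onto \<open>A\<close> whose kernel is \<open>N\<close>, since \<open>g\<close> is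
    injective.\<close>
  define p where "p = (\<lambda>w. g (N #>\<^bsub>F\<^esub> w))"
  have p_hom: "p \<in> hom F A"
    using hom_compose[OF N.r_coset_hom_Mod, of g A] g
    by (simp add: p_def comp_def iso_def)
  interpret p: group_hom F A p
    using p_hom by (simp add: group_hom_def group_hom_axioms_def A.group_axioms F.group_axioms)
  interpret g: group_hom "F Mod N" A g
    using g by (simp add: group_hom_def group_hom_axioms_def A.group_axioms
        N.factorgroup_is_group iso_def)
  have g_bij: "bij_betw g (carrier (F Mod N)) (carrier A)"
    using g by (simp add: iso_def)
  have p_surj: "p ` carrier F = carrier A"
  proof -
    have "carrier (F Mod N) = (\<lambda>w. N #>\<^bsub>F\<^esub> w) ` carrier F"
      by (auto simp: FactGroup_def RCOSETS_def)
    then show ?thesis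
      using bij_betw_imp_surj_on[OF g_bij] by (simp add: p_def image_image)
  qed
  have p_ker: "kernel F A p = N"
  proof -
    have "p w = \<one>\<^bsub>A\<^esub> \<longleftrightarrow> w \<in> N" if w: "w \<in> carrier F" for w
    proof -
      have "N #>\<^bsub>F\<^esub> w \<in> carrier (F Mod N)"
        using w by (auto simp: FactGroup_def RCOSETS_def)
      then have "p w = \<one>\<^bsub>A\<^esub> \<longleftrightarrow> N #>\<^bsub>F\<^esub> w = \<one>\<^bsub>F Mod N\<^esub>"
        using g_bij g.hom_one g.G.one_closed unfolding p_def bij_betw_def
        by (metis inj_on_eq_iff)
      also have "\<dots> \<longleftrightarrow> N #>\<^bsub>F\<^esub> w = N"
        by (simp add: FactGroup_def)
      also have "\<dots> \<longleftrightarrow> w \<in> N"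
        using w F.coset_join1 F.coset_join2 N.subgroup_axioms N.subset by metis
      finally show ?thesis .
    qed
    then show ?thesis
      using N.subset by (auto simp: kernel_def)
  qed
  \<comment> \<open>The default value outside \<open>X\<close> makes \<open>v\<close> total with
    values in the carrier, so that it can later be listed along an initial segment of the
    naturals.\<close>
  define v where "v = (\<lambda>x. if x \<in> X then p [Gen x] else \<one>\<^bsub>A\<^esub>)"
  have gen: "(\<lambda>x. [Gen x]) \<in> X \<rightarrow> carrier F"
    by (simp add: F_def carrier_free_group)
  \<comment> \<open>A homomorphism out of the free group is determined by its values on the
    generators.\<close>
  have p_eq: "p w = word_val A v w" if w: "w \<in> carrier F" for w
  proof -
    have wX: "word_over X w" using w by (simp add: F_def carrier_free_group)
    have "p w = p (word_val F (\<lambda>x. [Gen x]) w)"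
      using w by (simp add: F_def word_val_free_group)
    also have "\<dots> = word_val A (p \<circ> (\<lambda>x. [Gen x])) w"
      using p.hom_word_val[OF gen wX] .
    also have "\<dots> = word_val A v w"
      by (rule word_val_cong[OF wX]) (simp add: v_def)
    finally show ?thesis .
  qed
  show thesis
  proof (rule that[OF fin R])
    show "v \<in> UNIV \<rightarrow> carrier A"
      using p.hom_closed gen by (auto simp: v_def Pi_iff)
    show "word_val A v ` carrier (free_group X) = carrier A"
      using p_surj p_eq by (simp add: F_def)
    show "kernel (free_group X) A (word_val A v) = normal_closure (free_group X) R"
      using p_ker p_eq by (fastforce simp: kernel_def F_def N_def)
  qed
qed

section \<open>Positive existential embeddings\<close>

lemma pos_ex_embedding_hom:
  assumes "group A" "group B" and f: "pos_ex_embedding A B f"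
  shows "f \<in> hom A B"
proof (rule homI)
  interpret A: group A by fact
  interpret B: group B by fact
  show closed: "f x \<in> carrier B" if "x \<in> carrier A" for x
    using f that by (auto simp: pos_ex_embedding_def)
  fix x y assume xy: "x \<in> carrier A" "y \<in> carrier A"
  \<comment> \<open>The graph of multiplication is given by a single equation, with the product
    entered as a third parameter.\<close>
  let ?\<phi> = "Exists 0 (Eq [Gen (Inl 0), Gen (Inl 1)] [Gen (Inl 2)])"
  let ?as = "[x, y, x \<otimes>\<^bsub>A\<^esub> y]"
  have "pos_ex_formula_in 3 ?\<phi>" by auto
  moreover have "models A ?\<phi> ?as" using xy by simp
  moreover have "length ?as = 3" "set ?as \<subseteq> carrier A" using xy by simp_all
  ultimately have "models B ?\<phi> (map f ?as)"
    using f unfolding pos_ex_embedding_def by blast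
  then show "f (x \<otimes>\<^bsub>A\<^esub> y) = f x \<otimes>\<^bsub>B\<^esub> f y"
    using xy closed by simp
qed

text \<open>\<open>pos_qf\<close> has no truth constant; the trivial equation
  \<open>Eq [] []\<close> serves as the empty conjunction.\<close>

definition equations :: "('v word \<times> 'v word) list \<Rightarrow> 'v pos_qf" where
  "equations es = foldr (\<lambda>(s, t). Conj (Eq s t)) es (Eq [] [])"

lemma pqf_holds_equations:
  "pqf_holds G v (equations es) \<longleftrightarrow> (\<forall>(s, t)\<in>set es. word_val G v s = word_val G v t)"
  by (induction es) (auto simp: equations_def)

lemma pqf_vars_equations: "pqf_vars (equations es) = (\<Union>(s, t)\<in>set es. pqf_vars (Eq s t))"
  by (induction es) (simp_all add: equations_def case_prod_beta)

text \<open>Here the embedding is used from \<open>B\<close> back to \<open>A\<close>, whereas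
  \<open>pos_ex_embedding_hom\<close> uses it from \<open>A\<close> to \<open>B\<close>.\<close>

lemma pos_ex_embedding_reflects_system:
  fixes X :: "nat set"
  assumes "group A" "group B" and f: "pos_ex_embedding A B f" and fin: "finite X" "finite R"
    and R: "\<And>r. r \<in> R \<Longrightarrow> word_over X r" and w: "\<And>j. j \<in> X \<Longrightarrow> word_over X (w j)"
    and a: "a \<in> UNIV \<rightarrow> carrier A" and c: "c \<in> UNIV \<rightarrow> carrier B"
    and c_R: "\<And>r. r \<in> R \<Longrightarrow> word_val B c r = \<one>\<^bsub>B\<^esub>"
    and c_w: "\<And>j. j \<in> X \<Longrightarrow> f (a j) = word_val B c (w j)"
  obtains b where "b \<in> X \<rightarrow> carrier A" "\<And>r. r \<in> R \<Longrightarrow> word_val A b r = \<one>\<^bsub>A\<^esub>"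
    "\<And>j. j \<in> X \<Longrightarrow> a j = word_val A b (w j)"
proof -
  interpret A: group A by fact
  interpret B: group B by fact
  \<comment> \<open>\<open>X\<close> may have gaps, while tuples are indexed by all of
    \<open>{..<n}\<close>. The entries outside \<open>X\<close> are mere filler, but must lie in the
    carriers; hence the total \<open>a\<close> and \<open>c\<close>.\<close>
  obtain n where n: "X \<subseteq> {..<n}"
    using fin finite_nat_set_iff_bounded[of X] by auto
  let ?y = "map (map_letter Inr) :: nat word \<Rightarrow> (nat + nat) word"
  \<comment> \<open>All letters of \<open>r\<close> and \<open>w j\<close> become bound variables by
    \<open>?y\<close>; the free variable \<open>Inl j\<close> stands alone on its left side. The
    list thus encodes \<open>r(y) = 1\<close> and \<open>x\<^sub>j = w\<^sub>j(y)\<close>.\<close>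
  obtain es where es: "set es = (\<lambda>r. (?y r, [])) ` R \<union> (\<lambda>j. ([Gen (Inl j)], ?y (w j))) ` X"
    using fin finite_list[of "(\<lambda>r. (?y r, [])) ` R \<union> (\<lambda>j. ([Gen (Inl j)], ?y (w j))) ` X"] by auto
  let ?\<phi> = "Exists n (equations es)"
  let ?as = "map a [0..<n]"
  have "pos_ex_formula_in n ?\<phi>"
    using n R w by (fastforce simp: pqf_vars_equations es letter.set_map)
  moreover have "length ?as = n" "set ?as \<subseteq> carrier A"
    using a by auto
  moreover have "models B ?\<phi> (map f ?as)"
  proof -
    let ?cs = "map c [0..<n]"
    have eq: "word_val B ((!) ?cs) u = word_val B c u" if "word_over X u" for u
      using n by (intro word_val_cong[OF that]) auto
    have "pqf_holds B (case_sum (\<lambda>i. map f ?as ! i) (\<lambda>j. ?cs ! j)) (equations es)"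
      using n a c c_R c_w R w
      by (auto simp: pqf_holds_equations es word_val_map comp_def eq Pi_iff subset_iff
          B.word_val_closed[of c UNIV] simp del: map_map)
    moreover have "length ?cs = n" "set ?cs \<subseteq> carrier B"
      using c by auto
    ultimately show ?thesis
      by (simp only: models.simps) blast
  qed
  ultimately have "models A ?\<phi> ?as"
    using f unfolding pos_ex_embedding_def by blast
  then obtain bs where bs: "length bs = n" "set bs \<subseteq> carrier A"
    and holds: "pqf_holds A (case_sum (\<lambda>i. ?as ! i) (\<lambda>j. bs ! j)) (equations es)"
    by (auto simp only: models.simps)
  show thesis
  proof (rule that)
    show "(!) bs \<in> X \<rightarrow> carrier A"
      using bs n by (auto intro!: subsetD[OF bs(2)] nth_mem)
    show "word_val A ((!) bs) r = \<one>\<^bsub>A\<^esub>" if "r \<in> R" for r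
    proof -
      have "(?y r, []) \<in> set es" using that by (simp add: es)
      then show ?thesis
        using holds by (fastforce simp: pqf_holds_equations word_val_map comp_def)
    qed
    show "a j = word_val A ((!) bs) (w j)" if "j \<in> X" for j
    proof -
      have "([Gen (Inl j)], ?y (w j)) \<in> set es" using that by (simp add: es)
      \<comment> \<open>\<open>word_val\<close> closes every product with the unit, hence the
        trailing factor in the value of \<open>[Gen (Inl j)]\<close>.\<close>
      then have "?as ! j \<otimes>\<^bsub>A\<^esub> \<one>\<^bsub>A\<^esub> = word_val A ((!) bs) (w j)"
        using holds by (fastforce simp: pqf_holds_equations word_val_map comp_def)
      moreover have "?as ! j = a j" "a j \<in> carrier A" using that n a by auto
      ultimately show ?thesis by simp
    qed
  qed
qed

section \<open>The left inverse of an embedding\<close>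

theorem theorem1p8:
  fixes A :: "('a, 'b) monoid_scheme"
  assumes "group A"
    and "weakly_hopfian A"
    and "finitely_presented A"
  shows "strongly_defined_by_pos_ex_types A"
proof -
  interpret A: group A by fact
  obtain X :: "nat set" and R v where fin: "finite X" "finite R"
    and R: "R \<subseteq> carrier (free_group X)" and v: "v \<in> UNIV \<rightarrow> carrier A"
    and surj: "word_val A v ` carrier (free_group X) = carrier A"
    and ker: "kernel (free_group X) A (word_val A v) = normal_closure (free_group X) R"
    using finitely_presented_cases[OF assms(1,3)] .
  interpret F: group "free_group X" by (rule group_free_group)
  have hom: "group_hom (free_group X) A (word_val A u)" if "u \<in> X \<rightarrow> carrier A" for u
    using A.word_val_hom[OF that]
    by (simp add: group_hom_def group_hom_axioms_def F.group_axioms A.group_axioms)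
  have vX: "v \<in> X \<rightarrow> carrier A" using v by auto
  interpret p: group_hom "free_group X" A "word_val A v" by (rule hom[OF vX])
  have v_R: "word_val A v r = \<one>\<^bsub>A\<^esub>" if "r \<in> R" for r
  proof -
    have "r \<in> normal_closure (free_group X) R"
      using that by (auto simp: normal_closure_def)
    then show ?thesis by (simp add: kernel_def flip: ker)
  qed
  have "finitely_generated A"
    unfolding finitely_generated_def
  proof (intro exI conjI)
    show "finite (v ` X)" "v ` X \<subseteq> carrier A" using fin v by auto
    then have "generate A (v ` X) \<subseteq> carrier A" by (auto dest: A.generate_in_carrier)
    moreover have "carrier A \<subseteq> generate A (v ` X)"
      by (auto simp: carrier_free_group A.word_val_in_generate simp flip: surj)
    ultimately show "generate A (v ` X) = carrier A" by blast
  qed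
  moreover have "f \<in> iso A A" if f: "pos_ex_embedding A A f" for f
  proof -
    have f_hom: "f \<in> hom A A"
      using pos_ex_embedding_hom[OF assms(1,1) f] .
    \<comment> \<open>The word exists even for \<open>j\<close> outside \<open>X\<close>, since
      \<open>v\<close> maps everything into the carrier and evaluation at \<open>v\<close> is
      onto.\<close>
    have "\<exists>w. w \<in> carrier (free_group X) \<and> f (v j) = word_val A v w" for j
    proof -
      have "f (v j) \<in> word_val A v ` carrier (free_group X)"
        using f_hom v by (auto simp: surj hom_def)
      then show ?thesis by blast
    qed
    then obtain w where w: "\<And>j. w j \<in> carrier (free_group X)" "\<And>j. f (v j) = word_val A v (w j)"
      by metis
    obtain b where b: "b \<in> X \<rightarrow> carrier A" and b_R: "\<And>r. r \<in> R \<Longrightarrow> word_val A b r = \<one>\<^bsub>A\<^esub>"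
      and b_w: "\<And>j. j \<in> X \<Longrightarrow> v j = word_val A b (w j)"
    proof -
      have "word_over X r" if "r \<in> R" for r
        using subsetD[OF R that] by (simp add: carrier_free_group)
      moreover have "word_over X (w j)" for j
        using w(1) by (simp add: carrier_free_group)
      \<comment> \<open>Both \<open>a\<close> and \<open>c\<close> are taken to be \<open>v\<close>:
        by the choice of \<open>w\<close>, the tuple \<open>v\<close> is a witness for the formula
        at its own image under \<open>f\<close>.\<close>
      ultimately show thesis
        using pos_ex_embedding_reflects_system[OF assms(1,1) f fin _ _ v v v_R w(2)] that by blast
    qed
    interpret q: group_hom "free_group X" A "word_val A b" by (rule hom[OF b])
    \<comment> \<open>Von Dyck's argument: \<open>b\<close> satisfies the relators, so evaluation at
      \<open>b\<close> kills their normal closure and factors through \<open>A\<close>.\<close>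
    have "kernel (free_group X) A (word_val A v) \<subseteq> kernel (free_group X) A (word_val A b)"
      unfolding ker using q.normal_closure_subset_kernel[OF R b_R] .
    then obtain \<beta> where \<beta>: "\<beta> \<in> hom A A"
      and \<beta>_val: "\<And>u. u \<in> carrier (free_group X) \<Longrightarrow> \<beta> (word_val A v u) = word_val A b u"
      using p.factor_through_surj[OF surj A.group_axioms q.homh] by blast
    have "\<beta> \<circ> f \<in> hom A A" using hom_compose[OF f_hom \<beta>] .
    then interpret \<beta>f: group_hom A A "\<beta> \<circ> f"
      by (simp add: group_hom_def group_hom_axioms_def A.group_axioms)
    have "\<beta> (f x) = x" if "x \<in> carrier A" for x
    proof -
      obtain u where u: "word_over X u" "x = word_val A v u"
        using \<open>x \<in> carrier A\<close> by (auto simp: carrier_free_group simp flip: surj)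
      have "\<beta> (f x) = word_val A ((\<beta> \<circ> f) \<circ> v) u"
        using \<beta>f.hom_word_val[OF vX u(1)] u(2) by simp
      \<comment> \<open>On a generator, \<open>\<beta> (f (v j))\<close> is \<beta> of the value of
        \<open>w j\<close> at \<open>v\<close>, which is the value of \<open>w j\<close> at
        \<open>b\<close>, that is, \<open>v j\<close>.\<close>
      also have "\<dots> = word_val A v u"
        by (rule word_val_cong[OF u(1)]) (simp add: w \<beta>_val flip: b_w)
      finally show ?thesis using u(2) by simp
    qed
    then show ?thesis
      using assms(2) f_hom \<beta> unfolding weakly_hopfian_def by blast
  qed
  ultimately show ?thesis by (simp add: strongly_defined_by_pos_ex_types_def)
qed

end
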